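(* Let $(X,d,\alpha)$ be an effective metric space, let $(X,\varrho)$ be the represented space generated by it, let $X^*$ be the Moschovakis extension of $X$, and let $\varrho^*$ be the representation of $X^*$ associated with $\varrho$. Let $d^*:X^*\times X^*\to\mathbb{R}$ and $\alpha^*:\mathbb{N}\to X^*$ be the functions defined inductively in the context from $d$ and $\alpha$. Then the triple $(X^*,d^*,\alpha^* )$ is an effective metric space, and $(X^*,\varrho^* )$ is the represented space generated by it. In addition, if the effective metric space $(X,d,\alpha)$ is semicomputable or computable, then the effective metric space $(X^*,d^*,\alpha^* )$ is, respectively, also semicomputable or computable.
   Context: A representation of a set is a partial mapping of $\mathbb{N}^{\mathbb{N}}$ onto that set; a represented space is a pair (set, representation of that set). An effective metric space is a triple $(X,d,\alpha)$, where $(X,d)$ is a metric space, $\alpha:\mathbb{N}\to X$, and $\mathrm{rng}(\alpha)$ is dense in $(X,d)$. The represented space generated by it is $(X,\varrho)$, where $\varrho(p)=x$ iff $d(\alpha(p(k)),x)<2^{-k}$ for all $k\in\mathbb{N}$ (for $p\in\mathbb{N}^{\mathbb{N}}$, $x\in X$). The space $(X,d,\alpha)$ is semicomputable if the set $\{(i,j,k,l)\in\mathbb{N}^4\mid d(\alpha(i),\alpha(j))<\frac{k+1}{l+1}\}$ is recursively enumerable; it is computable if there is a computable function $\delta:\mathbb{N}^3\to\mathbb{Q}$ such that $|\delta(i,j,k)-d(\alpha(i),\alpha(j))|<2^{-k}$ for all $i,j,k\in\mathbb{N}$. Moschovakis extension: fix an object $\boldsymbol{o}\notin X$ and an ordered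 pair operation such that no element of $X\cup\{\boldsymbol{o}\}$ is an ordered pair; $X^*$ is the closure of $X\cup\{\boldsymbol{o}\}$ under formation of ordered pairs. $J:\mathbb{N}^2\to\mathbb{N}$ is a fixed computable bijection with $J(m,n)\ge\max(m,n)$ for all $m,n$. For a represented space $(X,\varrho)$, the partial mapping $\varrho^*$ of $\mathbb{N}^{\mathbb{N}}$ onto $X^*$ is defined inductively (with $k$ ranging over $\mathbb{N}$): (i) for $q\in\mathrm{dom}(\varrho)$, the sequence $k\mapsto 2q(k)+2$ is in $\mathrm{dom}(\varrho^* )$ and is mapped to $\varrho(q)$; (ii) the constant sequence $k\mapsto 0$ is in $\mathrm{dom}(\varrho^* )$ and is mapped to $\boldsymbol{o}$; (iii) if $q,r\in\mathrm{dom}(\varrho^* )$ then the sequence $k\mapsto 2J(q(k),r(k))+1$ is in $\mathrm{dom}(\varrho^* )$ and is mapped to $(\varrho^*(q),\varrho^*(r))$. Definition of $d^*$: $d^*(x,x')=\min(d(x,x'),1)$ for $x,x'\in X$; $d^*(\boldsymbol{o},\boldsymbol{o})=0$; $d^*(\boldsymbol{o},x)=d^*(x,\boldsymbol{o})=1$ for $x\in X$; $d^*(z,z')=d^*(z',z)=1$ whenever $z\in X\cup\{\boldsymbol{o}\}$ and $z'\in X^*\setminus(X\cup\{\boldsymbol{o}\})$; $d^*((u,v),(u',v'))=\max(d^*(u,u'),d^*(v,v'))$ for $u,v,u',v'\in X^*$. Definition of $\alpha^*$: $\alpha^*(2i+2)=\alpha(i)$ for $i\in\mathbb{N}$; $\alpha^*(0)=\boldsymbol{o}$;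 $\alpha^*(2J(m,n)+1)=(\alpha^*(m),\alpha^*(n))$ for $m,n\in\mathbb{N}$. *)

theory Defs
  imports "HOL-Analysis.Analysis"
begin

section \<open>Computability on the natural numbers\<close>

text \<open>
  The total recursive functions of \<open>n\<close> arguments, with argument tuples written as lists of
  length \<open>n\<close>: the closure of the basic functions under substitution, primitive recursion and
  minimization of regular functions.  The rule \<open>ext\<close> makes the values on lists of any other
  length irrelevant.
\<close>

inductive total_recursive :: "nat \<Rightarrow> (nat list \<Rightarrow> nat) \<Rightarrow> bool" where
  zero: "total_recursive n (\<lambda>xs. 0)"
| succ: "total_recursive 1 (\<lambda>xs. Suc (xs ! 0))"
| proj: "i < n \<Longrightarrow> total_recursive n (\<lambda>xs. xs ! i)"
| subst: "\<lbrakk>total_recursive (length gs) f; \<forall>g \<in> set gs. total_recursive n g\<rbrakk>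
    \<Longrightarrow> total_recursive n (\<lambda>xs. f (map (\<lambda>g. g xs) gs))"
| prim_rec: "\<lbrakk>total_recursive n f; total_recursive (Suc (Suc n)) g\<rbrakk>
    \<Longrightarrow> total_recursive (Suc n)
          (\<lambda>xs. rec_nat (f (tl xs)) (\<lambda>y r. g (y # r # tl xs)) (hd xs))"
| minimize: "\<lbrakk>total_recursive (Suc n) f; \<forall>xs. length xs = n \<longrightarrow> (\<exists>y. f (y # xs) = 0)\<rbrakk>
    \<Longrightarrow> total_recursive n (\<lambda>xs. LEAST y. f (y # xs) = 0)"
| ext: "\<lbrakk>total_recursive n f; \<forall>xs. length xs = n \<longrightarrow> g xs = f xs\<rbrakk>
    \<Longrightarrow> total_recursive n g"

text \<open>A set of \<open>n\<close>-tuples is recursively enumerable if it is empty or can be listed by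
  recursive coordinate functions.\<close>

definition recursively_enumerable :: "nat \<Rightarrow> nat list set \<Rightarrow> bool" where
  "recursively_enumerable n A \<longleftrightarrow>
     A = {} \<or>
     (\<exists>fs. length fs = n \<and> (\<forall>f \<in> set fs. total_recursive 1 f) \<and>
           A = range (\<lambda>t. map (\<lambda>f. f [t]) fs))"

text \<open>A rational-valued function is computable if its values can be written as \<open>(a - b)/(c + 1)\<close>
  with natural numbers \<open>a\<close>, \<open>b\<close>, \<open>c\<close> depending recursively on the arguments.\<close>

definition computable_rat_fun3 :: "(nat \<Rightarrow> nat \<Rightarrow> nat \<Rightarrow> rat) \<Rightarrow> bool" where
  "computable_rat_fun3 \<delta> \<longleftrightarrow>
     (\<exists>a b c. total_recursive 3 a \<and> total_recursive 3 b \<and> total_recursive 3 c \<and>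
        (\<forall>i j k. \<delta> i j k =
           (of_nat (a [i, j, k]) - of_nat (b [i, j, k])) / (of_nat (c [i, j, k]) + 1)))"

definition admissible_pairing :: "(nat \<Rightarrow> nat \<Rightarrow> nat) \<Rightarrow> bool" where
  "admissible_pairing J \<longleftrightarrow>
     total_recursive 2 (\<lambda>xs. J (xs ! 0) (xs ! 1)) \<and>
     bij (\<lambda>(m, n). J m n) \<and>
     (\<forall>m n. max m n \<le> J m n)"


section \<open>Effective metric spaces and represented spaces\<close>

locale effective_metric_space = Metric_space M d
  for M :: "'a set" and d :: "'a \<Rightarrow> 'a \<Rightarrow> real" +
  fixes \<alpha> :: "nat \<Rightarrow> 'a"
  assumes range_subset: "range \<alpha> \<subseteq> M"
    and dense: "mtopology closure_of (range \<alpha>) = M"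

definition semicomputable :: "('a \<Rightarrow> 'a \<Rightarrow> real) \<Rightarrow> (nat \<Rightarrow> 'a) \<Rightarrow> bool" where
  "semicomputable d \<alpha> \<longleftrightarrow>
     recursively_enumerable 4
       {[i, j, k, l] | i j k l. d (\<alpha> i) (\<alpha> j) < (real k + 1) / (real l + 1)}"

definition computable :: "('a \<Rightarrow> 'a \<Rightarrow> real) \<Rightarrow> (nat \<Rightarrow> 'a) \<Rightarrow> bool" where
  "computable d \<alpha> \<longleftrightarrow>
     (\<exists>\<delta>. computable_rat_fun3 \<delta> \<and>
        (\<forall>i j k. \<bar>real_of_rat (\<delta> i j k) - d (\<alpha> i) (\<alpha> j)\<bar> < 1 / 2 ^ k))"

text \<open>Representations are partial maps from Baire space, hence of type \<open>(nat \<Rightarrow> nat) \<rightharpoonup> 'a\<close>.\<close>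

definition represented_space :: "'a set \<Rightarrow> ((nat \<Rightarrow> nat) \<rightharpoonup> 'a) \<Rightarrow> bool" where
  "represented_space X \<rho> \<longleftrightarrow> ran \<rho> = X"

definition generates ::
    "'a set \<Rightarrow> ('a \<Rightarrow> 'a \<Rightarrow> real) \<Rightarrow> (nat \<Rightarrow> 'a) \<Rightarrow> ((nat \<Rightarrow> nat) \<rightharpoonup> 'a) \<Rightarrow> bool" where
  "generates X d \<alpha> \<rho> \<longleftrightarrow>
     represented_space X \<rho> \<and>
     (\<forall>p. \<forall>x \<in> X. \<rho> p = Some x \<longleftrightarrow> (\<forall>k. d (\<alpha> (p k)) x < 1 / 2 ^ k))"


section \<open>The Moschovakis extension\<close>

text \<open>
  \<open>X\<close>, the object \<open>\<oo>\<close> and the results of the pairing operation \<open>pr\<close> all live in one ambient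
  type \<open>'a\<close>, so that \<open>X\<close> is literally a subset of its extension.
\<close>

definition moschovakis_base :: "'a set \<Rightarrow> 'a \<Rightarrow> ('a \<Rightarrow> 'a \<Rightarrow> 'a) \<Rightarrow> bool" where
  "moschovakis_base X \<oo> pr \<longleftrightarrow>
     \<oo> \<notin> X \<and>
     (\<forall>u v u' v'. pr u v = pr u' v' \<longleftrightarrow> u = u' \<and> v = v') \<and>
     (\<forall>u v. pr u v \<notin> X \<union> {\<oo>})"

inductive_set star :: "'a set \<Rightarrow> 'a \<Rightarrow> ('a \<Rightarrow> 'a \<Rightarrow> 'a) \<Rightarrow> 'a set"
  for X :: "'a set" and \<oo> :: 'a and pr :: "'a \<Rightarrow> 'a \<Rightarrow> 'a" where
  base: "x \<in> X \<Longrightarrow> x \<in> star X \<oo> pr"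
| obj: "\<oo> \<in> star X \<oo> pr"
| pair: "\<lbrakk>u \<in> star X \<oo> pr; v \<in> star X \<oo> pr\<rbrakk> \<Longrightarrow> pr u v \<in> star X \<oo> pr"

text \<open>
  The representation, the metric and the enumeration of the extension are defined inductively by
  their graphs.  The lemmas at the end of this theory derive the defining equations, which
  confirms that the graphs are functional.
\<close>

inductive rho_star_graph ::
    "(nat \<Rightarrow> nat \<Rightarrow> nat) \<Rightarrow> 'a \<Rightarrow> ('a \<Rightarrow> 'a \<Rightarrow> 'a) \<Rightarrow> ((nat \<Rightarrow> nat) \<rightharpoonup> 'a) \<Rightarrow> (nat \<Rightarrow> nat) \<Rightarrow> 'a \<Rightarrow> bool"
  for J \<oo> pr \<rho> where
  base: "\<rho> q = Some x \<Longrightarrow> rho_star_graph J \<oo> pr \<rho> (\<lambda>k. 2 * q k + 2) x"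
| obj: "rho_star_graph J \<oo> pr \<rho> (\<lambda>k. 0) \<oo>"
| pair: "\<lbrakk>rho_star_graph J \<oo> pr \<rho> q u; rho_star_graph J \<oo> pr \<rho> r v\<rbrakk>
    \<Longrightarrow> rho_star_graph J \<oo> pr \<rho> (\<lambda>k. 2 * J (q k) (r k) + 1) (pr u v)"

definition rho_star ::
    "(nat \<Rightarrow> nat \<Rightarrow> nat) \<Rightarrow> 'a \<Rightarrow> ('a \<Rightarrow> 'a \<Rightarrow> 'a) \<Rightarrow> ((nat \<Rightarrow> nat) \<rightharpoonup> 'a) \<Rightarrow> ((nat \<Rightarrow> nat) \<rightharpoonup> 'a)" where
  "rho_star J \<oo> pr \<rho> p =
     (if \<exists>z. rho_star_graph J \<oo> pr \<rho> p z then Some (THE z. rho_star_graph J \<oo> pr \<rho> p z) else None)"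

inductive d_star_graph ::
    "'a set \<Rightarrow> 'a \<Rightarrow> ('a \<Rightarrow> 'a \<Rightarrow> 'a) \<Rightarrow> ('a \<Rightarrow> 'a \<Rightarrow> real) \<Rightarrow> 'a \<Rightarrow> 'a \<Rightarrow> real \<Rightarrow> bool"
  for X \<oo> pr d where
  base_base: "\<lbrakk>x \<in> X; x' \<in> X\<rbrakk> \<Longrightarrow> d_star_graph X \<oo> pr d x x' (min (d x x') 1)"
| obj_obj: "d_star_graph X \<oo> pr d \<oo> \<oo> 0"
| obj_base: "x \<in> X \<Longrightarrow> d_star_graph X \<oo> pr d \<oo> x 1"
| base_obj: "x \<in> X \<Longrightarrow> d_star_graph X \<oo> pr d x \<oo> 1"
| atom_pair: "\<lbrakk>z \<in> X \<union> {\<oo>}; z' \<in> star X \<oo> pr - (X \<union> {\<oo>})\<rbrakk> \<Longrightarrow> d_star_graph X \<oo> pr d z z' 1"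
| pair_atom: "\<lbrakk>z \<in> X \<union> {\<oo>}; z' \<in> star X \<oo> pr - (X \<union> {\<oo>})\<rbrakk> \<Longrightarrow> d_star_graph X \<oo> pr d z' z 1"
| pair_pair: "\<lbrakk>d_star_graph X \<oo> pr d u u' r; d_star_graph X \<oo> pr d v v' s\<rbrakk>
    \<Longrightarrow> d_star_graph X \<oo> pr d (pr u v) (pr u' v') (max r s)"

text \<open>The value 0 outside the extension is a dummy: the locale \<open>Metric_space\<close> asks for a
  nonnegative symmetric function on the whole type.\<close>

definition d_star ::
    "'a set \<Rightarrow> 'a \<Rightarrow> ('a \<Rightarrow> 'a \<Rightarrow> 'a) \<Rightarrow> ('a \<Rightarrow> 'a \<Rightarrow> real) \<Rightarrow> 'a \<Rightarrow> 'a \<Rightarrow> real" where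
  "d_star X \<oo> pr d z z' =
     (if z \<in> star X \<oo> pr \<and> z' \<in> star X \<oo> pr then THE r. d_star_graph X \<oo> pr d z z' r else 0)"

inductive alpha_star_graph ::
    "(nat \<Rightarrow> nat \<Rightarrow> nat) \<Rightarrow> 'a \<Rightarrow> ('a \<Rightarrow> 'a \<Rightarrow> 'a) \<Rightarrow> (nat \<Rightarrow> 'a) \<Rightarrow> nat \<Rightarrow> 'a \<Rightarrow> bool"
  for J \<oo> pr \<alpha> where
  base: "alpha_star_graph J \<oo> pr \<alpha> (2 * i + 2) (\<alpha> i)"
| obj: "alpha_star_graph J \<oo> pr \<alpha> 0 \<oo>"
| pair: "\<lbrakk>alpha_star_graph J \<oo> pr \<alpha> m u; alpha_star_graph J \<oo> pr \<alpha> n v\<rbrakk>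
    \<Longrightarrow> alpha_star_graph J \<oo> pr \<alpha> (2 * J m n + 1) (pr u v)"

definition alpha_star ::
    "(nat \<Rightarrow> nat \<Rightarrow> nat) \<Rightarrow> 'a \<Rightarrow> ('a \<Rightarrow> 'a \<Rightarrow> 'a) \<Rightarrow> (nat \<Rightarrow> 'a) \<Rightarrow> nat \<Rightarrow> 'a" where
  "alpha_star J \<oo> pr \<alpha> n = (THE z. alpha_star_graph J \<oo> pr \<alpha> n z)"


section \<open>The defining equations\<close>

lemma admissible_pairing_eq_iff:
  assumes "admissible_pairing J"
  shows "J m n = J m' n' \<longleftrightarrow> m = m' \<and> n = n'"
proof -
  have "inj (\<lambda>(m, n). J m n)"
    using assms by (simp add: admissible_pairing_def bij_is_inj)
  from inj_eq[OF this, of "(m, n)" "(m', n')"] show ?thesis by simp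
qed

lemma rho_star_graph_unique:
  assumes J: "admissible_pairing J"
  shows "rho_star_graph J \<oo> pr \<rho> p z \<Longrightarrow> rho_star_graph J \<oo> pr \<rho> p z' \<Longrightarrow> z = z'"
proof (induction p z arbitrary: z' rule: rho_star_graph.induct)
  case (base q x)
  from base.prems show ?case
  proof cases
    case (base q')
    then have "q' = q" by (auto simp: fun_eq_iff)
    with base \<open>\<rho> q = Some x\<close> show ?thesis by simp
  next
    case obj then show ?thesis by (auto simp: fun_eq_iff)
  next
    case (pair q' u' r' v')
    then have "2 * q 0 + 2 = 2 * J (q' 0) (r' 0) + 1" by (auto simp: fun_eq_iff)
    then show ?thesis by presburger
  qed
next
  case obj
  then show ?case by cases (auto simp: fun_eq_iff)
next
  case (pair q u r v)
  from pair.prems show ?case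
  proof cases
    case (base q')
    then have "2 * q' 0 + 2 = 2 * J (q 0) (r 0) + 1" by (metis (no_types, lifting))
    then show ?thesis by presburger
  next
    case obj
    then show ?thesis by (auto simp: fun_eq_iff)
  next
    case (pair q' u' r' v')
    then have "q' = q" "r' = r"
      by (auto simp: fun_eq_iff admissible_pairing_eq_iff[OF J])
    with pair pair.IH show ?thesis by simp
  qed
qed

lemma rho_star_eq_Some_iff:
  assumes "admissible_pairing J"
  shows "rho_star J \<oo> pr \<rho> p = Some z \<longleftrightarrow> rho_star_graph J \<oo> pr \<rho> p z"
proof -
  have "(THE z. rho_star_graph J \<oo> pr \<rho> p z) = w" if "rho_star_graph J \<oo> pr \<rho> p w" for w
    using that by (blast intro: the_equality rho_star_graph_unique[OF assms])
  then show ?thesis unfolding rho_star_def by (metis option.distinct(1) option.inject)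
qed

lemma rho_star_equations:
  assumes "admissible_pairing J"
  shows "\<rho> q = Some x \<Longrightarrow> rho_star J \<oo> pr \<rho> (\<lambda>k. 2 * q k + 2) = Some x"
    and "rho_star J \<oo> pr \<rho> (\<lambda>k. 0) = Some \<oo>"
    and "\<lbrakk>rho_star J \<oo> pr \<rho> q = Some u; rho_star J \<oo> pr \<rho> r = Some v\<rbrakk>
           \<Longrightarrow> rho_star J \<oo> pr \<rho> (\<lambda>k. 2 * J (q k) (r k) + 1) = Some (pr u v)"
  unfolding rho_star_eq_Some_iff[OF assms] by (fact rho_star_graph.intros)+

lemma star_cases_pair:
  assumes "z \<in> star X \<oo> pr" "z \<notin> X" "z \<noteq> \<oo>"
  obtains u v where "z = pr u v" "u \<in> star X \<oo> pr" "v \<in> star X \<oo> pr"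
  using assms by (auto elim: star.cases)

lemma d_star_graph_unique:
  assumes B: "moschovakis_base X \<oo> pr"
  shows "d_star_graph X \<oo> pr d z z' r \<Longrightarrow> d_star_graph X \<oo> pr d z z' s \<Longrightarrow> r = s"
proof (induction z z' r arbitrary: s rule: d_star_graph.induct)
  case (pair_pair u u' r v v' t)
  from pair_pair.prems show ?case
    by cases (use B pair_pair.IH in \<open>auto simp: moschovakis_base_def\<close>)
qed (use B in \<open>auto simp: moschovakis_base_def elim: d_star_graph.cases\<close>)

lemma d_star_graph_total:
  assumes "z \<in> star X \<oo> pr" "z' \<in> star X \<oo> pr"
  shows "\<exists>r. d_star_graph X \<oo> pr d z z' r"
  using assms
proof (induction z arbitrary: z' rule: star.induct)
  case (pair u v)
  show ?case
  proof (cases "pr u v \<in> X \<union> {\<oo>} \<or> z' \<in> X \<union> {\<oo>}")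
    case True
    with pair show ?thesis
      by (metis Diff_iff UnE d_star_graph.intros singletonD star.pair)
  next
    case False
    with pair.prems obtain u' v' where "z' = pr u' v'" "u' \<in> star X \<oo> pr" "v' \<in> star X \<oo> pr"
      by (auto elim: star_cases_pair)
    with pair.IH show ?thesis by (metis d_star_graph.pair_pair)
  qed
qed (metis Diff_iff UnCI UnE d_star_graph.intros singletonD singletonI)+

lemma d_star_eqI:
  assumes "moschovakis_base X \<oo> pr" "z \<in> star X \<oo> pr" "z' \<in> star X \<oo> pr"
    and "d_star_graph X \<oo> pr d z z' r"
  shows "d_star X \<oo> pr d z z' = r"
  using assms d_star_graph_unique[OF assms(1)] by (auto simp: d_star_def intro!: the_equality)

lemma d_star_graph_d_star:
  assumes "moschovakis_base X \<oo> pr" "z \<in> star X \<oo> pr" "z' \<in> star X \<oo> pr"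
  shows "d_star_graph X \<oo> pr d z z' (d_star X \<oo> pr d z z')"
  using d_star_graph_total[OF assms(2,3)] d_star_eqI[OF assms] by metis

lemma d_star_equations:
  assumes B: "moschovakis_base X \<oo> pr"
  shows "\<lbrakk>x \<in> X; x' \<in> X\<rbrakk> \<Longrightarrow> d_star X \<oo> pr d x x' = min (d x x') 1"
    and "d_star X \<oo> pr d \<oo> \<oo> = 0"
    and "x \<in> X \<Longrightarrow> d_star X \<oo> pr d \<oo> x = 1"
    and "x \<in> X \<Longrightarrow> d_star X \<oo> pr d x \<oo> = 1"
    and "\<lbrakk>z \<in> X \<union> {\<oo>}; z' \<in> star X \<oo> pr - (X \<union> {\<oo>})\<rbrakk> \<Longrightarrow> d_star X \<oo> pr d z z' = 1"
    and "\<lbrakk>z \<in> X \<union> {\<oo>}; z' \<in> star X \<oo> pr - (X \<union> {\<oo>})\<rbrakk> \<Longrightarrow> d_star X \<oo> pr d z' z = 1"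
    and "\<lbrakk>u \<in> star X \<oo> pr; v \<in> star X \<oo> pr; u' \<in> star X \<oo> pr; v' \<in> star X \<oo> pr\<rbrakk> \<Longrightarrow>
           d_star X \<oo> pr d (pr u v) (pr u' v') = max (d_star X \<oo> pr d u u') (d_star X \<oo> pr d v v')"
  by (rule d_star_eqI[OF B];
      auto intro: star.intros d_star_graph.intros d_star_graph_d_star[OF B])+

lemma alpha_star_graph_unique:
  assumes J: "admissible_pairing J"
  shows "alpha_star_graph J \<oo> pr \<alpha> n z \<Longrightarrow> alpha_star_graph J \<oo> pr \<alpha> n z' \<Longrightarrow> z = z'"
proof (induction n z arbitrary: z' rule: alpha_star_graph.induct)
  case (base i)
  from base show ?case by cases (auto, presburger)
next
  case obj
  then show ?case by cases auto
next
  case (pair m u n v)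
  from pair.prems show ?case
    by cases (use pair.IH in \<open>auto simp: admissible_pairing_eq_iff[OF J]\<close>, presburger)
qed

lemma alpha_star_graph_total:
  assumes J: "admissible_pairing J"
  shows "\<exists>z. alpha_star_graph J \<oo> pr \<alpha> n z"
proof (induction n rule: less_induct)
  case (less n)
  consider "n = 0" | i where "n = 2 * i + 2" | j where "n = 2 * j + 1"
    by (metis One_nat_def add_2_eq_Suc' add_Suc_right evenE mult_Suc_right not0_implies_Suc oddE add.commute)
  then show ?case
  proof cases
    case (3 j)
    have "surj (\<lambda>(m, n). J m n)"
      using J by (simp add: admissible_pairing_def bij_is_surj)
    then obtain a b where j: "j = J a b" by (metis surj_def case_prod_conv surj_pair)
    have "max a b \<le> j" using J j by (simp add: admissible_pairing_def)
    then have "a < n" "b < n" using 3 by auto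
    with less.IH show ?thesis using 3 j by (metis alpha_star_graph.pair)
  qed (metis alpha_star_graph.base alpha_star_graph.obj)+
qed

lemma alpha_star_eq_iff:
  assumes "admissible_pairing J"
  shows "alpha_star J \<oo> pr \<alpha> n = z \<longleftrightarrow> alpha_star_graph J \<oo> pr \<alpha> n z"
  using alpha_star_graph_total[OF assms] alpha_star_graph_unique[OF assms]
  unfolding alpha_star_def by (metis the_equality)

lemma alpha_star_equations:
  assumes J: "admissible_pairing J"
  shows "alpha_star J \<oo> pr \<alpha> (2 * i + 2) = \<alpha> i"
    and "alpha_star J \<oo> pr \<alpha> 0 = \<oo>"
    and "alpha_star J \<oo> pr \<alpha> (2 * J m n + 1) = pr (alpha_star J \<oo> pr \<alpha> m) (alpha_star J \<oo> pr \<alpha> n)"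
  using alpha_star_eq_iff[OF J] alpha_star_graph.intros by metis+

end

theory Submission
  imports Defs
begin

text \<open>
  The metric part is structural induction.  Points of different shapes have distance 1, so every
  claim reduces to points of the same shape: points of \<open>X\<close>, where \<open>min d 1\<close> is a metric, and pairs, where a
  maximum of metrics is one.  For the representation, a code at distance less than 1 from a point
  has the shape of that point (\<open>ds_alpha_star_atom\<close>, \<open>ds_alpha_star_obj\<close>, \<open>ds_alpha_star_pair\<close>);
  hence a sequence that approximates a point at the rate \<open>1 / 2 ^ k\<close> decomposes
  entry by entry as the definition of the representation demands (\<open>generates_star\<close>).

  For the effective part the obstacle is that \<open>d_star\<close> recurs along two codes simultaneously,
  whereas primitive recursion descends from one number to its predecessor.  Instead of simulating a
  course-of-values recursion, the recursion is unfolded into paths.  A number \<open>w < 2 ^ n\<close> is read as a sequence of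
  \<open>n\<close> left-right decisions, which lead from a pair of codes down to a pair of components (\<open>walk\<close>);
  this is the iteration of one function on coded states and thus recursive.  As \<open>d_star\<close> of two
  pairs is a maximum, the distance at the root is the maximum of the distances reached by all these
  paths (\<open>code_dist_walk_le\<close>, \<open>code_dist_walk_eq\<close>), and for \<open>n\<close> at least the left code all paths end
  where at least one code stands for no pair (\<open>leaf_walk\<close>), with an explicit distance
  (\<open>code_dist_leaf\<close>).

  Semicomputability follows because recursively enumerable sets are the projections of decidable
  ones (\<open>recursively_enumerable_projection\<close>, \<open>recursively_enumerable_imp_projection\<close>) and are
  closed under bounded universal quantification, here over the paths.  Computability follows
  because a maximum of \<open>\<epsilon>\<close>-approximations is an \<open>\<epsilon>\<close>-approximation of the maximum.
\<close>

section \<open>Recursive functions and decidable predicates\<close>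

lemma total_recursive_subst:
  assumes "total_recursive (length gs) f" "\<And>g. g \<in> set gs \<Longrightarrow> total_recursive n g"
    and eq: "\<And>xs. length xs = n \<Longrightarrow> h xs = map (\<lambda>g. g xs) gs"
  shows "total_recursive n (\<lambda>xs. f (h xs))"
  by (rule total_recursive.ext[OF total_recursive.subst[of gs f n]]) (simp_all add: assms)

lemma total_recursive_comp1:
  assumes "total_recursive 1 (\<lambda>xs. F (xs ! 0))" "total_recursive n f"
  shows "total_recursive n (\<lambda>xs. F (f xs))"
  using total_recursive.subst[of "[f]" "\<lambda>xs. F (xs ! 0)" n] assms by simp

lemma total_recursive_comp2:
  assumes "total_recursive 2 (\<lambda>xs. F (xs ! 0) (xs ! 1))" "total_recursive n f" "total_recursive n g"
  shows "total_recursive n (\<lambda>xs. F (f xs) (g xs))"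
  using total_recursive.subst[of "[f, g]" "\<lambda>xs. F (xs ! 0) (xs ! 1)" n] assms
  by (simp add: numeral_2_eq_2)

lemma total_recursive_Suc: "total_recursive n f \<Longrightarrow> total_recursive n (\<lambda>xs. Suc (f xs))"
  by (rule total_recursive_comp1[OF total_recursive.succ])

lemma total_recursive_const: "total_recursive n (\<lambda>xs. c)"
  by (induction c) (auto intro: total_recursive.zero total_recursive_Suc)

lemma total_recursive_tl:
  assumes "total_recursive n f"
  shows "total_recursive (Suc n) (\<lambda>xs. f (tl xs))"
  by (rule total_recursive_subst[of "map (\<lambda>i xs. xs ! Suc i) [0..<n]"])
    (use assms in \<open>auto intro: total_recursive.proj nth_equalityI simp: nth_tl\<close>)

lemma total_recursive_Cons:
  assumes "total_recursive (Suc n) f" "total_recursive n b"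
  shows "total_recursive n (\<lambda>xs. f (b xs # xs))"
  by (rule total_recursive_subst[of "b # map (\<lambda>i xs. xs ! i) [0..<n]"])
    (use assms in \<open>auto intro: total_recursive.proj nth_equalityI\<close>)

text \<open>A bound variable of a recursion, a quantifier or a minimization is the head of the argument
  list, the parameters being its tail.  Stating the rules with \<open>g y r xs\<close> for separate variables
  keeps them higher-order patterns, so that \<open>intro\<close> can decompose a term by its syntax alone.\<close>

lemma total_recursive_rec_nat:
  assumes f: "total_recursive n f"
    and g: "total_recursive (Suc (Suc n)) (\<lambda>zs. g (zs ! 0) (zs ! 1) (tl (tl zs)))"
    and b: "total_recursive n b"
  shows "total_recursive n (\<lambda>xs. rec_nat (f xs) (\<lambda>y r. g y r xs) (b xs))"
  using total_recursive_Cons[OF total_recursive.prim_rec[OF f g] b] by simp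

lemmas total_recursive_basics =
  total_recursive_const total_recursive.proj total_recursive_Suc
  total_recursive_tl[OF total_recursive.proj]
  total_recursive_tl[OF total_recursive_tl[OF total_recursive.proj]]

lemma total_recursive_add:
  assumes "total_recursive n f" "total_recursive n g"
  shows "total_recursive n (\<lambda>xs. f xs + g xs)"
proof -
  have "rec_nat a (\<lambda>_ r. Suc r) b = a + b" for a b by (induction b) auto
  moreover have "total_recursive n (\<lambda>xs. rec_nat (f xs) (\<lambda>_ r. Suc r) (g xs))"
    by (intro total_recursive_rec_nat assms total_recursive_basics) auto
  ultimately show ?thesis by simp
qed

lemma total_recursive_mult:
  assumes "total_recursive n f" "total_recursive n g"
  shows "total_recursive n (\<lambda>xs. f xs * g xs)"
proof -
  have "rec_nat 0 (\<lambda>_ r. r + a) b = a * b" for a b by (induction b) auto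
  moreover have "total_recursive n (\<lambda>xs. rec_nat 0 (\<lambda>_ r. r + f xs) (g xs))"
    by (intro total_recursive_rec_nat assms total_recursive_basics total_recursive_add
        total_recursive_tl[OF total_recursive_tl[OF assms(1)]]) auto
  ultimately show ?thesis by simp
qed

lemma total_recursive_power2:
  assumes "total_recursive n f"
  shows "total_recursive n (\<lambda>xs. 2 ^ f xs)"
proof -
  have "rec_nat (Suc 0) (\<lambda>_ r. r + r) b = 2 ^ b" for b by (induction b) auto
  moreover have "total_recursive n (\<lambda>xs. rec_nat (Suc 0) (\<lambda>_ r. r + r) (f xs))"
    by (intro total_recursive_rec_nat assms total_recursive_basics total_recursive_add) auto
  ultimately show ?thesis by simp
qed

lemma total_recursive_diff:
  assumes "total_recursive n f" "total_recursive n g"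
  shows "total_recursive n (\<lambda>xs. f xs - g xs)"
proof -
  have pred: "rec_nat 0 (\<lambda>y _. y) b = b - 1" for b by (cases b) auto
  have "rec_nat a (\<lambda>_ r. r - 1) b = a - b" for a b by (induction b) auto
  moreover have "total_recursive n (\<lambda>xs. rec_nat (f xs) (\<lambda>_ r. rec_nat 0 (\<lambda>y _. y) r) (g xs))"
    by (intro total_recursive_rec_nat assms total_recursive_basics) auto
  ultimately show ?thesis unfolding pred by simp
qed

text \<open>Truth is coded by 0, so that minimization, which looks for a zero, finds the least witness.\<close>

definition decidable :: "nat \<Rightarrow> (nat list \<Rightarrow> bool) \<Rightarrow> bool" where
  "decidable n P \<longleftrightarrow> total_recursive n (\<lambda>xs. if P xs then 0 else 1)"

lemma decidable_zero:
  assumes "total_recursive n f"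
  shows "decidable n (\<lambda>xs. f xs = 0)"
proof -
  have "rec_nat 0 (\<lambda>_ _. 1) b = (if b = 0 then 0 else 1 :: nat)" for b by (cases b) auto
  moreover have "total_recursive n (\<lambda>xs. rec_nat 0 (\<lambda>_ _. 1) (f xs))"
    by (intro total_recursive_rec_nat assms total_recursive_basics)
  ultimately show ?thesis by (simp add: decidable_def)
qed

lemma total_recursive_if:
  assumes "decidable n P" "total_recursive n f" "total_recursive n g"
  shows "total_recursive n (\<lambda>xs. if P xs then f xs else g xs)"
proof -
  have "rec_nat a (\<lambda>_ _. c) (if p then 0 else 1) = (if p then a else c)" for p and a c :: nat
    by simp
  moreover have
    "total_recursive n (\<lambda>xs. rec_nat (f xs) (\<lambda>_ _. g xs) (if P xs then 0 else 1))"
    using assms unfolding decidable_def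
    by (intro total_recursive_rec_nat total_recursive_tl)
  ultimately show ?thesis by simp
qed

lemma decidable_le:
  "total_recursive n f \<Longrightarrow> total_recursive n g \<Longrightarrow> decidable n (\<lambda>xs. f xs \<le> g xs)"
  using decidable_zero[OF total_recursive_diff[of n f g]] by simp

lemma decidable_less:
  "total_recursive n f \<Longrightarrow> total_recursive n g \<Longrightarrow> decidable n (\<lambda>xs. f xs < g xs)"
  using decidable_le[OF total_recursive_Suc[of n f], of g] by (simp add: Suc_le_eq)

lemma decidable_not:
  assumes "decidable n P"
  shows "decidable n (\<lambda>xs. \<not> P xs)"
proof -
  have "total_recursive n (\<lambda>xs. if P xs then 1 else 0)"
    by (intro total_recursive_if assms total_recursive_const)
  then show ?thesis
    unfolding decidable_def by (rule total_recursive.ext) auto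
qed

lemma decidable_conj:
  assumes "decidable n P" "decidable n Q"
  shows "decidable n (\<lambda>xs. P xs \<and> Q xs)"
proof -
  have "total_recursive n (\<lambda>xs. if P xs then if Q xs then 0 else 1 else 1)"
    by (intro total_recursive_if assms total_recursive_const)
  then show ?thesis
    unfolding decidable_def by (rule total_recursive.ext) auto
qed

lemma decidable_disj: "decidable n P \<Longrightarrow> decidable n Q \<Longrightarrow> decidable n (\<lambda>xs. P xs \<or> Q xs)"
  using decidable_not[OF decidable_conj[OF decidable_not[of n P] decidable_not[of n Q]]] by simp

lemma decidable_eq:
  "total_recursive n f \<Longrightarrow> total_recursive n g \<Longrightarrow> decidable n (\<lambda>xs. f xs = g xs)"
  using decidable_conj[OF decidable_le[of n f g] decidable_le[of n g f]] by (simp add: eq_iff)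

lemma decidable_bex:
  assumes P: "decidable (Suc n) (\<lambda>ys. P (ys ! 0) (tl ys))" and b: "total_recursive n b"
  shows "decidable n (\<lambda>xs. \<exists>y<b xs. P y xs)"
proof -
  have "rec_nat 1 (\<lambda>y r. if Q y then 0 else r) b = (if \<exists>y<b. Q y then 0 else 1 :: nat)" for Q b
    by (induction b) (auto simp: less_Suc_eq)
  moreover have "decidable (Suc (Suc n)) (\<lambda>zs. P (zs ! 0) (tl (tl zs)))"
  proof -
    have "total_recursive (Suc (Suc n))
        (\<lambda>zs. (\<lambda>ys. if P (ys ! 0) (tl ys) then 0 else 1) (zs ! 0 # tl (tl zs)))"
      by (rule total_recursive_subst[of "(\<lambda>zs. zs ! 0) # map (\<lambda>i zs. zs ! Suc (Suc i)) [0..<n]"])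
        (use P in \<open>auto intro: total_recursive.proj nth_equalityI simp: decidable_def nth_tl\<close>)
    then show ?thesis by (simp add: decidable_def)
  qed
  then have "total_recursive n (\<lambda>xs. rec_nat 1 (\<lambda>y r. if P y xs then 0 else r) (b xs))"
    by (intro total_recursive_rec_nat b total_recursive_basics total_recursive_if) auto
  ultimately show ?thesis by (simp add: decidable_def)
qed

lemma decidable_ball:
  assumes "decidable (Suc n) (\<lambda>ys. P (ys ! 0) (tl ys))" "total_recursive n b"
  shows "decidable n (\<lambda>xs. \<forall>y<b xs. P y xs)"
  using decidable_not[OF decidable_bex[of n "\<lambda>y xs. \<not> P y xs"]] assms decidable_not by simp

lemma total_recursive_Least:
  assumes P: "decidable (Suc n) (\<lambda>ys. P (ys ! 0) (tl ys))"
    and ex: "\<And>xs. length xs = n \<Longrightarrow> \<exists>y. P y xs"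
  shows "total_recursive n (\<lambda>xs. LEAST y. P y xs)"
proof -
  have "total_recursive n (\<lambda>xs. LEAST y. (if P ((y # xs) ! 0) (tl (y # xs)) then 0 else 1) = (0::nat))"
    using P ex unfolding decidable_def by (intro total_recursive.minimize) auto
  moreover have "((if p then 0 else 1) = (0::nat)) = p" for p by simp
  ultimately show ?thesis by simp
qed

lemmas recursive_intros =
  total_recursive_basics total_recursive_add total_recursive_mult total_recursive_power2
  total_recursive_diff total_recursive_if
  decidable_le decidable_less decidable_not decidable_conj decidable_disj decidable_eq

text \<open>Iterating a transition function on coded states makes up for the fixed parameters of primitive
  recursion.\<close>

lemma total_recursive_funpow:
  assumes "total_recursive 1 (\<lambda>xs. F (xs ! 0))" "total_recursive n f" "total_recursive n g"
  shows "total_recursive n (\<lambda>xs. (F ^^ f xs) (g xs))"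
proof -
  have "rec_nat a (\<lambda>_. F) b = (F ^^ b) a" for a b by (induction b) auto
  moreover have "total_recursive n (\<lambda>xs. rec_nat (g xs) (\<lambda>_. F) (f xs))"
    by (intro total_recursive_rec_nat assms total_recursive_comp1[OF assms(1)] total_recursive_basics) auto
  ultimately show ?thesis by simp
qed

lemma total_recursive_mod2:
  assumes "total_recursive n f"
  shows "total_recursive n (\<lambda>xs. f xs mod 2)"
proof -
  have "rec_nat 0 (\<lambda>_ r. 1 - r) b = b mod 2" for b :: nat
    by (induction b) (auto, presburger)
  moreover have "total_recursive n (\<lambda>xs. rec_nat 0 (\<lambda>_ r. 1 - r) (f xs))"
    by (intro total_recursive_rec_nat assms recursive_intros) auto
  ultimately show ?thesis by simp
qed

lemma decidable_even: "total_recursive n f \<Longrightarrow> decidable n (\<lambda>xs. even (f xs))"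
  using decidable_zero[OF total_recursive_mod2[of n f]] by (simp add: even_iff_mod_2_eq_zero)

lemma total_recursive_div2:
  assumes "total_recursive n f"
  shows "total_recursive n (\<lambda>xs. f xs div 2)"
proof -
  have "rec_nat 0 (\<lambda>y r. r + y mod 2) b = b div 2" for b :: nat
    by (induction b) (auto, presburger)
  moreover have "total_recursive n (\<lambda>xs. rec_nat 0 (\<lambda>y r. r + y mod 2) (f xs))"
    by (intro total_recursive_rec_nat assms recursive_intros total_recursive_mod2) auto
  ultimately show ?thesis by simp
qed

section \<open>Tuple coding and recursively enumerable sets\<close>

locale pairing =
  fixes J :: "nat \<Rightarrow> nat \<Rightarrow> nat"
  assumes admissible: "admissible_pairing J"
begin

definition left :: "nat \<Rightarrow> nat" where
  "left s = fst (inv (\<lambda>(m, n). J m n) s)"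

definition right :: "nat \<Rightarrow> nat" where
  "right s = snd (inv (\<lambda>(m, n). J m n) s)"

lemma left_J [simp]: "left (J m n) = m" and right_J [simp]: "right (J m n) = n"
proof -
  have "inj (\<lambda>(m, n). J m n)" using admissible by (simp add: admissible_pairing_def bij_is_inj)
  from inv_f_f[OF this, of "(m, n)"] show "left (J m n) = m" "right (J m n) = n"
    by (simp_all add: left_def right_def)
qed

lemma J_left_right [simp]: "J (left s) (right s) = s"
proof -
  have "surj (\<lambda>(m, n). J m n)" using admissible by (simp add: admissible_pairing_def bij_is_surj)
  from surj_f_inv_f[OF this, of s] show ?thesis
    unfolding left_def right_def by (simp only: case_prod_beta)
qed

lemma J_ge: "m \<le> J m n" "n \<le> J m n"
  using admissible unfolding admissible_pairing_def by (meson max.boundedE)+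

lemma left_le: "left s \<le> s" and right_le: "right s \<le> s"
  by (metis J_ge(1) J_left_right, metis J_ge(2) J_left_right)

lemma total_recursive_J:
  "total_recursive n f \<Longrightarrow> total_recursive n g \<Longrightarrow> total_recursive n (\<lambda>xs. J (f xs) (g xs))"
  by (rule total_recursive_comp2[of J]) (use admissible in \<open>simp_all add: admissible_pairing_def\<close>)

text \<open>Since \<open>J\<close> dominates its arguments, the search for the components of \<open>s\<close> can be bounded
  by \<open>s\<close>; only the outer search uses minimization.\<close>

lemma total_recursive_left:
  assumes "total_recursive n f"
  shows "total_recursive n (\<lambda>xs. left (f xs))"
proof (rule total_recursive_comp1[of left, OF _ assms])
  have "left s = (LEAST m. \<exists>n<Suc s. J m n = s)" for s
  proof (rule Least_equality[symmetric])
    show "\<exists>n<Suc s. J (left s) n = s" using right_le[of s] J_left_right[of s] less_Suc_eq_le by blast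
  qed auto
  moreover have "total_recursive 1 (\<lambda>xs. LEAST m. \<exists>n<Suc (xs ! 0). J m n = xs ! 0)"
  proof (rule total_recursive_Least)
    show "\<exists>m. \<exists>n<Suc (xs ! 0). J m n = xs ! 0" for xs
      using right_le[of "xs ! 0"] J_left_right[of "xs ! 0"] less_Suc_eq_le by blast
    show "decidable (Suc 1) (\<lambda>ys. \<exists>n<Suc (tl ys ! 0). J (ys ! 0) n = tl ys ! 0)"
      by (intro decidable_bex recursive_intros total_recursive_J) auto
  qed
  ultimately show "total_recursive 1 (\<lambda>xs. left (xs ! 0))" by simp
qed

lemma total_recursive_right:
  assumes "total_recursive n f"
  shows "total_recursive n (\<lambda>xs. right (f xs))"
proof (rule total_recursive_comp1[of right, OF _ assms])
  have "right s = (LEAST n. J (left s) n = s)" for s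
    by (rule Least_equality[symmetric]) (simp, metis right_J order_refl)
  moreover have "total_recursive 1 (\<lambda>xs. LEAST n. J (left (xs ! 0)) n = xs ! 0)"
  proof (rule total_recursive_Least)
    show "\<exists>n. J (left (xs ! 0)) n = xs ! 0" for xs
      by (rule exI[of _ "right (xs ! 0)"]) simp
    show "decidable (Suc 1) (\<lambda>ys. J (left (tl ys ! 0)) (ys ! 0) = tl ys ! 0)"
      by (intro recursive_intros total_recursive_J total_recursive_left) auto
  qed
  ultimately show "total_recursive 1 (\<lambda>xs. right (xs ! 0))" by simp
qed

lemmas pairing_intros = recursive_intros total_recursive_mod2 total_recursive_div2 decidable_even
  total_recursive_J total_recursive_left total_recursive_right

text \<open>A single number codes tuples of every length: entry \<open>i\<close> is read off by \<open>i\<close> steps to the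
  right and one to the left.\<close>

lemma ex_code: "\<exists>s. \<forall>i<length xs. left ((right ^^ i) s) = xs ! i"
proof (induction xs)
  case (Cons x xs)
  then obtain s where s: "\<forall>i<length xs. left ((right ^^ i) s) = xs ! i" by blast
  have "left ((right ^^ i) (J x s)) = (x # xs) ! i" if "i < length (x # xs)" for i
    using s that by (cases i) (auto simp: funpow_Suc_right simp del: funpow.simps)
  then show ?case by blast
qed simp

text \<open>A number \<open>s\<close> codes a candidate \<open>t # xs\<close>.  Listing \<open>xs\<close> when \<open>f (t # xs) = 0\<close>, and a
  fixed element \<open>cs\<close> otherwise, enumerates exactly the projection.\<close>

lemma recursively_enumerable_projection:
  assumes f: "total_recursive (Suc n) f"
  shows "recursively_enumerable n {xs. length xs = n \<and> (\<exists>t. f (t # xs) = 0)}"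
    (is "recursively_enumerable n ?A")
proof (cases "?A = {}")
  case False
  then obtain cs where cs: "cs \<in> ?A" by blast
  define c where "c s i = left ((right ^^ i) s)" for s i
  define h where "h = (\<lambda>i (ts :: nat list). if f (map (c (ts ! 0)) [0..<Suc n]) = 0
      then c (ts ! 0) (Suc i) else cs ! i)"
  have c: "total_recursive 1 (\<lambda>ts. c (ts ! 0) i)" for i
    unfolding c_def by (intro pairing_intros total_recursive_funpow) auto
  have "total_recursive 1 (\<lambda>ts. f (map (\<lambda>g. g ts) (map (\<lambda>i ts. c (ts ! 0) i) [0..<Suc n])))"
    by (rule total_recursive.subst) (use f c in \<open>auto simp del: upt_Suc\<close>)
  then have "total_recursive 1 (\<lambda>ts. f (map (c (ts ! 0)) [0..<Suc n]))"
    by (simp add: comp_def del: upt_Suc)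
  then have "total_recursive 1 (h i)" for i
    unfolding h_def by (intro total_recursive_if decidable_zero c total_recursive_const)
  moreover have "?A = range (\<lambda>t. map (\<lambda>g. g [t]) (map h [0..<n]))"
  proof (intro equalityI subsetI)
    fix xs assume "xs \<in> ?A"
    then obtain t where t: "length xs = n" "f (t # xs) = 0" by blast
    obtain s where "\<forall>i<length (t # xs). left ((right ^^ i) s) = (t # xs) ! i"
      using ex_code[of "t # xs"] by blast
    then have s: "c s i = (t # xs) ! i" if "i < Suc n" for i using t that by (simp add: c_def)
    have tup: "map (c s) [0..<Suc n] = t # xs"
      by (rule nth_equalityI) (use t s in \<open>simp_all del: upt_Suc\<close>)
    have "h i [s] = xs ! i" if "i < n" for i
      unfolding h_def nth_Cons_0 tup using t(2) s[of "Suc i"] that by simp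
    then have "map (\<lambda>g. g [s]) (map h [0..<n]) = xs"
      by (intro nth_equalityI) (simp_all add: t(1))
    then show "xs \<in> range (\<lambda>t. map (\<lambda>g. g [t]) (map h [0..<n]))"
      by (rule range_eqI[OF sym])
  next
    fix xs assume "xs \<in> range (\<lambda>t. map (\<lambda>g. g [t]) (map h [0..<n]))"
    then obtain s where "xs = map (\<lambda>g. g [s]) (map h [0..<n])" by blast
    then have s: "xs = map (\<lambda>i. h i [s]) [0..<n]" by (simp add: comp_def)
    show "xs \<in> ?A"
    proof (cases "f (map (c s) [0..<Suc n]) = 0")
      case True
      then have "xs = map (\<lambda>i. c s (Suc i)) [0..<n]" using s by (simp add: h_def)
      then have "map (c s) [0..<Suc n] = c s 0 # xs"
        unfolding upt_conv_Cons[OF zero_less_Suc] map_Suc_upt[symmetric] by simp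
      with True have "f (c s 0 # xs) = 0" by (simp del: upt_Suc)
      moreover have "length xs = n" using s by simp
      ultimately show ?thesis by blast
    next
      case False
      then have "xs = cs" using s cs by (intro nth_equalityI) (simp_all add: h_def del: upt_Suc)
      with cs show ?thesis by simp
    qed
  qed
  ultimately show ?thesis
    unfolding recursively_enumerable_def by (intro disjI2 exI[of _ "map h [0..<n]"]) auto
qed (simp add: recursively_enumerable_def)

end

text \<open>Conversely, membership of \<open>xs\<close> is witnessed by the stage \<open>t\<close> at which \<open>xs\<close> is listed, and
  it is decidable whether a given stage lists \<open>xs\<close>.\<close>

lemma recursively_enumerable_imp_projection:
  assumes "recursively_enumerable n A"
  obtains f where "total_recursive (Suc n) f"
    "A = {xs. length xs = n \<and> (\<exists>t. f (t # xs) = 0)}"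
proof (cases "A = {}")
  case True
  show thesis by (rule that[of "\<lambda>_. 1"]) (use True in \<open>auto intro: total_recursive_const\<close>)
next
  case False
  with assms obtain fs where fs: "length fs = n" "\<forall>g\<in>set fs. total_recursive 1 g"
    and A: "A = range (\<lambda>t. map (\<lambda>g. g [t]) fs)"
    unfolding recursively_enumerable_def by auto
  have dec: "decidable (Suc n) (\<lambda>ys. \<forall>i<m. (fs ! i) [ys ! 0] = tl ys ! i)" if "m \<le> n" for m
    using that
  proof (induction m)
    case 0
    show ?case by (simp add: decidable_def total_recursive_const)
  next
    case (Suc m)
    have "total_recursive (Suc n) (\<lambda>ys. (fs ! m) (map (\<lambda>g. g ys) [\<lambda>ys. ys ! 0]))"
      by (rule total_recursive.subst) (use fs Suc.prems in \<open>auto intro: total_recursive.proj\<close>)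
    then have "decidable (Suc n) (\<lambda>ys. (fs ! m) [ys ! 0] = tl ys ! m)"
      using Suc.prems by (intro recursive_intros) auto
    moreover have "decidable (Suc n) (\<lambda>ys. \<forall>i<m. (fs ! i) [ys ! 0] = tl ys ! i)"
      using Suc by simp
    ultimately show ?case unfolding All_less_Suc by (rule decidable_conj)
  qed
  let ?f = "\<lambda>ys. if \<forall>i<n. (fs ! i) [ys ! 0] = tl ys ! i then 0 else (1::nat)"
  show thesis
  proof (rule that[of ?f])
    show "total_recursive (Suc n) ?f" using dec[of n] by (simp add: decidable_def)
    have "xs = map (\<lambda>g. g [t]) fs \<longleftrightarrow> length xs = n \<and> ?f (t # xs) = 0" for xs t
      using fs(1) by (auto simp: list_eq_iff_nth_eq)
    then show "A = {xs. length xs = n \<and> (\<exists>t. ?f (t # xs) = 0)}"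
      unfolding A by blast
  qed
qed

section \<open>The metric of the extension\<close>

locale moschovakis_extension = effective_metric_space X d \<alpha> + pairing J
  for X :: "'a set" and d :: "'a \<Rightarrow> 'a \<Rightarrow> real" and \<alpha> :: "nat \<Rightarrow> 'a"
    and J :: "nat \<Rightarrow> nat \<Rightarrow> nat" +
  fixes \<oo> :: 'a and pr :: "'a \<Rightarrow> 'a \<Rightarrow> 'a"
  assumes base: "moschovakis_base X \<oo> pr"
begin

abbreviation Xs :: "'a set" where "Xs \<equiv> star X \<oo> pr"
abbreviation ds :: "'a \<Rightarrow> 'a \<Rightarrow> real" where "ds \<equiv> d_star X \<oo> pr d"
abbreviation \<alpha>s :: "nat \<Rightarrow> 'a" where "\<alpha>s \<equiv> alpha_star J \<oo> pr \<alpha>"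

lemma pr_simps [simp]:
  "pr u v = pr u' v' \<longleftrightarrow> u = u' \<and> v = v'" "pr u v \<notin> X" "pr u v \<noteq> \<oo>" "\<oo> \<noteq> pr u v" "\<oo> \<notin> X"
  "x \<in> X \<Longrightarrow> x \<noteq> \<oo>" "x \<in> X \<Longrightarrow> \<oo> \<noteq> x" "x \<in> X \<Longrightarrow> x \<noteq> pr u v"
  using base by (auto simp: moschovakis_base_def)

lemma star_simps [simp]:
  "x \<in> X \<Longrightarrow> x \<in> Xs" "\<oo> \<in> Xs" "u \<in> Xs \<Longrightarrow> v \<in> Xs \<Longrightarrow> pr u v \<in> Xs"
  by (fact star.intros)+

lemma ds_simps [simp]:
  "x \<in> X \<Longrightarrow> x' \<in> X \<Longrightarrow> ds x x' = min (d x x') 1"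
  "ds \<oo> \<oo> = 0"
  "x \<in> X \<Longrightarrow> ds \<oo> x = 1"
  "x \<in> X \<Longrightarrow> ds x \<oo> = 1"
  "u \<in> Xs \<Longrightarrow> v \<in> Xs \<Longrightarrow> ds \<oo> (pr u v) = 1"
  "u \<in> Xs \<Longrightarrow> v \<in> Xs \<Longrightarrow> ds (pr u v) \<oo> = 1"
  "x \<in> X \<Longrightarrow> u \<in> Xs \<Longrightarrow> v \<in> Xs \<Longrightarrow> ds x (pr u v) = 1"
  "x \<in> X \<Longrightarrow> u \<in> Xs \<Longrightarrow> v \<in> Xs \<Longrightarrow> ds (pr u v) x = 1"
  "u \<in> Xs \<Longrightarrow> v \<in> Xs \<Longrightarrow> u' \<in> Xs \<Longrightarrow> v' \<in> Xs \<Longrightarrow> ds (pr u v) (pr u' v') = max (ds u u') (ds v v')"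
  by (simp_all add: d_star_equations[OF base])

lemma alpha_in_X [simp]: "\<alpha> i \<in> X"
  using range_subset by auto

lemma star_cases [consumes 1, case_names atom obj pair]:
  assumes "z \<in> Xs"
  obtains "z \<in> X" | "z = \<oo>" | u v where "z = pr u v" "u \<in> Xs" "v \<in> Xs"
  using assms by (cases rule: star.cases) auto

lemma code_cases [case_names atom obj pair]:
  obtains i where "n = 2 * i + 2" | "n = 0" | a b where "n = 2 * J a b + 1"
proof (cases "even n")
  case True
  then show ?thesis using that(1)[of "n div 2 - 1"] that(2) by (cases "n = 0") auto
next
  case False
  then show ?thesis using that(3)[of "left (n div 2)" "right (n div 2)"] by simp
qed

lemma alpha_star_simps [simp]:
  "\<alpha>s (2 * i + 2) = \<alpha> i" "\<alpha>s (Suc (Suc (2 * i))) = \<alpha> i" "\<alpha>s 0 = \<oo>"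
  "\<alpha>s (2 * J m n + 1) = pr (\<alpha>s m) (\<alpha>s n)" "\<alpha>s (Suc (2 * J m n)) = pr (\<alpha>s m) (\<alpha>s n)"
  using alpha_star_equations[OF admissible, of \<oo> pr \<alpha>] by simp_all

lemma alpha_star_in_star [simp]: "\<alpha>s n \<in> Xs"
proof -
  have "alpha_star_graph J \<oo> pr \<alpha> n (\<alpha>s n)"
    using alpha_star_eq_iff[OF admissible] by metis
  then show ?thesis by induction simp_all
qed

lemma ds_bounds:
  assumes "z \<in> Xs" "z' \<in> Xs"
  shows "0 \<le> ds z z' \<and> ds z z' \<le> 1"
  using assms
proof (induction z arbitrary: z' rule: star.induct)
  case (base x)
  from base(2) show ?case by (cases rule: star_cases) (use base in auto)
next
  case obj
  then show ?case by (cases rule: star_cases) auto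
next
  case (pair u v)
  from pair.prems show ?case
    by (cases rule: star_cases) (use pair in \<open>auto simp: le_max_iff_disj\<close>)
qed

lemma ds_commute:
  assumes "z \<in> Xs" "z' \<in> Xs"
  shows "ds z z' = ds z' z"
  using assms
proof (induction z arbitrary: z' rule: star.induct)
  case (base x)
  from base(2) show ?case by (cases rule: star_cases) (use base in \<open>auto simp: commute\<close>)
next
  case obj
  then show ?case by (cases rule: star_cases) auto
next
  case (pair u v)
  from pair.prems show ?case by (cases rule: star_cases) (use pair in auto)
qed

lemma ds_zero:
  assumes "z \<in> Xs" "z' \<in> Xs"
  shows "ds z z' = 0 \<longleftrightarrow> z = z'"
  using assms
proof (induction z arbitrary: z' rule: star.induct)
  case (base x)
  from base(2) show ?case
    by (cases rule: star_cases) (use base in \<open>auto simp: min_def\<close>)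
next
  case obj
  then show ?case by (cases rule: star_cases) auto
next
  case (pair u v)
  from pair.prems show ?case
  proof (cases rule: star_cases)
    case (pair u' v')
    then show ?thesis
      using pair.IH[of u'] pair.IH(2)[of v'] ds_bounds[of u u'] ds_bounds[of v v'] pair.hyps
      by (auto simp: max_def)
  qed (use pair in auto)
qed

text \<open>Elements of different shapes are at the maximal distance 1.  This disposes of all cases of the
  triangle inequality in which the three points do not have the same shape.\<close>

lemma ds_shape:
  assumes "z \<in> Xs"
  shows "x \<in> X \<Longrightarrow> z \<notin> X \<Longrightarrow> ds x z = 1 \<and> ds z x = 1"
    and "z \<noteq> \<oo> \<Longrightarrow> ds \<oo> z = 1 \<and> ds z \<oo> = 1"
    and "u \<in> Xs \<Longrightarrow> v \<in> Xs \<Longrightarrow> \<nexists>a b. a \<in> Xs \<and> b \<in> Xs \<and> z = pr a b \<Longrightarrow>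
      ds (pr u v) z = 1 \<and> ds z (pr u v) = 1"
  using assms by (cases rule: star_cases; auto)+

lemma ds_triangle:
  assumes "y \<in> Xs" "x \<in> Xs" "z \<in> Xs"
  shows "ds x z \<le> ds x y + ds y z"
  using assms
proof (induction y arbitrary: x z rule: star.induct)
  case (base y)
  show ?case
  proof (cases "x \<in> X \<and> z \<in> X")
    case True
    then have "d x z \<le> d x y + d y z" using base triangle by blast
    then have "min (d x z) 1 \<le> min (d x y) 1 + min (d y z) 1"
      using nonneg[of x y] nonneg[of y z] by linarith
    then show ?thesis using True base by simp
  next
    case False
    then have "ds x y = 1 \<or> ds y z = 1"
      using base ds_shape(1) by blast
    then show ?thesis
      using ds_bounds[of x z] ds_bounds[of x y] ds_bounds[of y z] base by fastforce
  qed
next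
  case obj
  show ?case
  proof (cases "x = \<oo> \<and> z = \<oo>")
    case False
    then have "ds x \<oo> = 1 \<or> ds \<oo> z = 1"
      using obj ds_shape(2) by blast
    then show ?thesis
      using ds_bounds[of x z] ds_bounds[of x \<oo>] ds_bounds[of \<oo> z] obj by fastforce
  qed auto
next
  case (pair u v)
  show ?case
  proof (cases "\<exists>a b a' b'. {a, b, a', b'} \<subseteq> Xs \<and> x = pr a b \<and> z = pr a' b'")
    case True
    then obtain a b a' b' where *: "a \<in> Xs" "b \<in> Xs" "a' \<in> Xs" "b' \<in> Xs" "x = pr a b" "z = pr a' b'"
      by auto
    show ?thesis
      using pair.IH(1)[of a a'] pair.IH(2)[of b b'] pair.hyps * by (auto simp: max_def)
  next
    case False
    then have "ds x (pr u v) = 1 \<or> ds (pr u v) z = 1"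
      using pair.hyps pair.prems ds_shape(3)[of x u v] ds_shape(3)[of z u v] by auto
    then show ?thesis
      using ds_bounds[of x z] ds_bounds[of x "pr u v"] ds_bounds[of "pr u v" z] pair by fastforce
  qed
qed

lemma Metric_space_star: "Metric_space Xs ds"
proof
  have outside: "ds x y = 0" if "\<not> (x \<in> Xs \<and> y \<in> Xs)" for x y
    using that by (simp only: d_star_def if_False)
  show "0 \<le> ds x y" for x y
    using ds_bounds[of x y] outside[of x y] by linarith
  show "ds x y = ds y x" for x y
    using ds_commute[of x y] outside[of x y] outside[of y x] by metis
  show "ds x y = 0 \<longleftrightarrow> x = y" if "x \<in> Xs" "y \<in> Xs" for x y
    using that by (rule ds_zero)
  show "ds x z \<le> ds x y + ds y z" if "x \<in> Xs" "y \<in> Xs" "z \<in> Xs" for x y z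
    using that(2,1,3) by (rule ds_triangle)
qed

section \<open>Density and the generated representation\<close>

lemma alpha_dense:
  assumes "x \<in> X" "e > 0"
  obtains i where "d (\<alpha> i) x < e"
proof -
  have "x \<in> mtopology closure_of range \<alpha>" using assms dense by simp
  then obtain y where "y \<in> range \<alpha>" "y \<in> mball x e"
    using assms unfolding metric_closure_of by blast
  then show thesis using that commute by (auto simp: in_mball)
qed

lemma alpha_star_dense:
  assumes "z \<in> Xs" "e > 0"
  shows "\<exists>n. ds (\<alpha>s n) z < e"
  using assms(1)
proof (induction z rule: star.induct)
  case (base x)
  obtain i where "d (\<alpha> i) x < e" using alpha_dense[OF base assms(2)] .
  then have "ds (\<alpha>s (2 * i + 2)) x < e" using base by (simp add: min_less_iff_disj)
  then show ?case ..
next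
  case obj
  have "ds (\<alpha>s 0) \<oo> < e" using assms(2) by simp
  then show ?case ..
next
  case (pair u v)
  then obtain m n where "ds (\<alpha>s m) u < e" "ds (\<alpha>s n) v < e" by blast
  then have "ds (\<alpha>s (2 * J m n + 1)) (pr u v) < e" using pair.hyps by simp
  then show ?case ..
qed

lemma effective_metric_space_star: "effective_metric_space Xs ds \<alpha>s"
proof -
  interpret S: Metric_space Xs ds by (rule Metric_space_star)
  have "S.mtopology closure_of range \<alpha>s = Xs"
  proof
    show "Xs \<subseteq> S.mtopology closure_of range \<alpha>s"
    proof
      fix z assume z: "z \<in> Xs"
      have "\<exists>y\<in>range \<alpha>s. y \<in> S.mball z e" if e: "e > 0" for e
      proof -
        obtain n where "ds (\<alpha>s n) z < e" using alpha_star_dense[OF z e] by blast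
        then have "\<alpha>s n \<in> S.mball z e"
          using z by (simp only: S.in_mball S.commute[of z "\<alpha>s n"] alpha_star_in_star simp_thms)
        then show ?thesis by blast
      qed
      then show "z \<in> S.mtopology closure_of range \<alpha>s"
        unfolding S.metric_closure_of by (intro CollectI conjI allI impI z)
    qed
    show "S.mtopology closure_of range \<alpha>s \<subseteq> Xs"
      using closure_of_subset_topspace[of S.mtopology] by simp
  qed
  moreover have "range \<alpha>s \<subseteq> Xs" by (rule image_subsetI) (rule alpha_star_in_star)
  ultimately have "effective_metric_space_axioms Xs ds \<alpha>s"
    by (simp only: effective_metric_space_axioms_def simp_thms)
  with Metric_space_star show ?thesis by (rule effective_metric_space.intro)
qed

text \<open>Distance less than 1 forces the code to have the shape of the point.  All entries of a sequence
  that approximates a point at the rate \<open>1 / 2 ^ k\<close> are this close, the one for \<open>k = 0\<close> included.\<close>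

lemma ds_alpha_star_atom:
  assumes "x \<in> X" "ds (\<alpha>s n) x < 1"
  obtains i where "n = 2 * i + 2"
  by (cases n rule: code_cases) (use assms that in auto)

lemma ds_alpha_star_obj:
  assumes "ds (\<alpha>s n) \<oo> < 1"
  shows "n = 0"
  by (cases n rule: code_cases) (use assms in auto)

lemma ds_alpha_star_pair:
  assumes "u \<in> Xs" "v \<in> Xs" "ds (\<alpha>s n) (pr u v) < 1"
  obtains a b where "n = 2 * J a b + 1"
  by (cases n rule: code_cases) (use assms that in auto)

text \<open>Induction on \<open>rho_star_graph\<close> shows that every name satisfies the metric condition.  The
  converse goes by induction on the point: the entries of \<open>p\<close> all have the shape of the point, so
  \<open>p\<close> is built from sequences for the components as in the definition of the representation.  In
  the atomic case the truncation of \<open>d\<close> at 1 is harmless because the bounds are at most 1.\<close>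

lemma generates_star:
  assumes gen: "generates X d \<alpha> \<rho>"
  shows "generates Xs ds \<alpha>s (rho_star J \<oo> pr \<rho>)"
proof -
  let ?G = "rho_star_graph J \<oo> pr \<rho>"
  have ran: "ran \<rho> = X"
    and rho: "\<And>p x. x \<in> X \<Longrightarrow> \<rho> p = Some x \<longleftrightarrow> (\<forall>k. d (\<alpha> (p k)) x < 1 / 2 ^ k)"
    using gen by (auto simp: generates_def represented_space_def)
  have le1: "1 / 2 ^ k \<le> (1 :: real)" for k by simp
  have star: "z \<in> Xs" if "?G p z" for p z
    using that
  proof induction
    case (base q x)
    then have "x \<in> X" using ran ranI by metis
    then show ?case by (rule star.base)
  qed (blast intro: star.intros)+
  have sound: "ds (\<alpha>s (p k)) z < 1 / 2 ^ k" if "?G p z" for p z k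
    using that
  proof induction
    case (base q x)
    then have "x \<in> X" using ran ranI by metis
    with base rho show ?case by (simp add: min_less_iff_disj)
  qed (use star in auto)
  have onto: "\<exists>p. ?G p z" if "z \<in> Xs" for z
    using that
  proof induction
    case (base x)
    then show ?case using ran by (auto simp: ran_def intro: rho_star_graph.base)
  qed (blast intro: rho_star_graph.intros)+
  have complete: "?G p z" if "z \<in> Xs" "\<And>k. ds (\<alpha>s (p k)) z < 1 / 2 ^ k" for p z
    using that
  proof (induction z arbitrary: p)
    case (base x)
    have "\<exists>i. p k = 2 * i + 2" for k
      using ds_alpha_star_atom[OF base(1) less_le_trans[OF base(2) le1]] by blast
    then obtain q where q: "\<And>k. p k = 2 * q k + 2" by metis
    have "d (\<alpha> (q k)) x < 1 / 2 ^ k" for k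
    proof -
      have "min (d (\<alpha> (q k)) x) 1 < 1 / 2 ^ k"
        using base(2)[of k] base(1) unfolding q by (simp only: alpha_star_simps ds_simps alpha_in_X)
      then show ?thesis using le1[of k] by linarith
    qed
    then have "\<rho> q = Some x" using rho base(1) by simp
    then have "?G (\<lambda>k. 2 * q k + 2) x" by (rule rho_star_graph.base)
    moreover have "p = (\<lambda>k. 2 * q k + 2)" by (simp add: fun_eq_iff q)
    ultimately show ?case by simp
  next
    case obj
    have "p k = 0" for k
      by (rule ds_alpha_star_obj[OF less_le_trans[OF obj le1]])
    then have "p = (\<lambda>k. 0)" by auto
    then show ?case by (simp add: rho_star_graph.obj)
  next
    case (pair u v)
    have "\<exists>a b. p k = 2 * J a b + 1" for k
      using ds_alpha_star_pair[OF pair.hyps less_le_trans[OF pair.prems le1]] by blast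
    then obtain q r where qr: "\<And>k. p k = 2 * J (q k) (r k) + 1" by metis
    have "max (ds (\<alpha>s (q k)) u) (ds (\<alpha>s (r k)) v) < 1 / 2 ^ k" for k
      using pair.prems[of k] pair.hyps
      unfolding qr by (simp only: alpha_star_simps ds_simps alpha_star_in_star)
    then have "?G q u" "?G r v" by (simp_all add: pair.IH)
    then have "?G (\<lambda>k. 2 * J (q k) (r k) + 1) (pr u v)" by (rule rho_star_graph.pair)
    moreover have "p = (\<lambda>k. 2 * J (q k) (r k) + 1)" by (simp add: fun_eq_iff qr)
    ultimately show ?case by simp
  qed
  show ?thesis
    unfolding generates_def represented_space_def ran_def rho_star_eq_Some_iff[OF admissible]
    using star sound onto complete by blast
qed

end

section \<open>Walking down two codes at once\<close>

context pairing
begin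

definition child :: "nat \<Rightarrow> nat \<Rightarrow> nat" where
  "child w n = (if even w then left (n div 2) else right (n div 2))"

text \<open>The number \<open>s\<close> codes a pair of codes.  Both components move in the same direction, and only if
  both stand for pairs; so a pair meeting an atom is frozen together with its distance 1.\<close>

definition step :: "nat \<Rightarrow> nat \<Rightarrow> nat" where
  "step w s = (if odd (left s) \<and> odd (right s) then J (child w (left s)) (child w (right s)) else s)"

text \<open>The binary digits of \<open>w\<close>, least significant first, are the directions.\<close>

primrec walk :: "nat \<Rightarrow> nat \<Rightarrow> nat \<Rightarrow> nat" where
  "walk 0 w s = s"
| "walk (Suc n) w s = walk n (w div 2) (step w s)"

definition leaf :: "nat \<Rightarrow> bool" where
  "leaf s \<longleftrightarrow> even (left s) \<or> even (right s)"

lemma walk_leaf_stop: "leaf s \<Longrightarrow> walk n w s = s"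
  by (induction n arbitrary: w) (auto simp: step_def leaf_def)

text \<open>The left code at least halves with every effective step, so its own value bounds the number of
  steps that are needed.\<close>

lemma leaf_walk: "left s \<le> n \<Longrightarrow> leaf (walk n w s)"
proof (induction n arbitrary: w s)
  case (Suc n)
  show ?case
  proof (cases "leaf s")
    case True
    then show ?thesis using walk_leaf_stop[of s "Suc n" w] by simp
  next
    case False
    then have odd: "odd (left s)" "odd (right s)" by (auto simp: leaf_def)
    have "left (step w s) \<le> left s div 2"
      using odd left_le right_le by (simp add: step_def child_def)
    moreover have "left s div 2 \<le> n" using Suc.prems by linarith
    ultimately show ?thesis using Suc.IH by simp
  qed
qed (simp add: leaf_def)

lemma total_recursive_step:
  assumes "total_recursive n f" "total_recursive n g"
  shows "total_recursive n (\<lambda>xs. step (f xs) (g xs))"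
  unfolding step_def child_def by (intro pairing_intros assms)

text \<open>The remaining directions and the current position form one coded state, on which a walk is the
  iteration of a fixed recursive function.\<close>

lemma total_recursive_walk:
  assumes "total_recursive n f" "total_recursive n g" "total_recursive n h"
  shows "total_recursive n (\<lambda>xs. walk (f xs) (g xs) (h xs))"
proof -
  define F where "F t = J (left t div 2) (step (left t) (right t))" for t
  have "total_recursive 1 (\<lambda>xs. F (xs ! 0))"
    unfolding F_def by (intro pairing_intros total_recursive_step) auto
  then have "total_recursive n (\<lambda>xs. right ((F ^^ f xs) (J (g xs) (h xs))))"
    by (intro total_recursive_right total_recursive_funpow total_recursive_J assms)
  moreover have "right ((F ^^ m) (J w s)) = walk m w s" for m w s
    by (induction m arbitrary: w s) (simp_all add: funpow_Suc_right F_def del: funpow.simps(2))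
  ultimately show ?thesis by simp
qed

end

section \<open>Semicomputability and computability\<close>

context moschovakis_extension
begin

definition code_dist :: "nat \<Rightarrow> real" where
  "code_dist s = ds (\<alpha>s (left s)) (\<alpha>s (right s))"

lemma code_dist_cases:
  obtains "leaf s" | a b a' b' where "left s = 2 * J a b + 1" "right s = 2 * J a' b' + 1"
    "code_dist s = max (code_dist (J a a')) (code_dist (J b b'))"
proof (cases "leaf s")
  case False
  then have odd: "odd (left s)" "odd (right s)" by (auto simp: leaf_def)
  obtain a b where ab: "left s = 2 * J a b + 1"
    using odd by (cases "left s" rule: code_cases) auto
  obtain a' b' where ab': "right s = 2 * J a' b' + 1"
    using odd by (cases "right s" rule: code_cases) auto
  have "code_dist s = max (code_dist (J a a')) (code_dist (J b b'))" by (simp add: code_dist_def ab ab')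
  then show ?thesis using that(2) ab ab' by blast
qed (use that in blast)

lemma code_dist_step_le: "code_dist (step w s) \<le> code_dist s"
proof (cases s rule: code_dist_cases)
  case 1
  then show ?thesis by (auto simp: step_def leaf_def)
next
  case (2 a b a' b')
  then show ?thesis by (simp add: step_def child_def)
qed

lemma code_dist_step_eq: "\<exists>b<2. code_dist (step b s) = code_dist s"
proof (cases s rule: code_dist_cases)
  case 1
  then have "code_dist (step 0 s) = code_dist s" by (auto simp: step_def leaf_def)
  then show ?thesis by (intro exI[of _ 0]) simp
next
  case (2 a b a' b')
  then have "code_dist (step 0 s) = code_dist (J a a')" "code_dist (step 1 s) = code_dist (J b b')"
    by (simp_all add: step_def child_def)
  then have "code_dist (step 0 s) = code_dist s \<or> code_dist (step 1 s) = code_dist s" unfolding 2(3) by (simp add: max_def)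
  then show ?thesis using zero_less_numeral one_less_numeral_iff semiring_norm(76) by metis
qed

lemma code_dist_walk_le: "code_dist (walk n w s) \<le> code_dist s"
proof (induction n arbitrary: w s)
  case (Suc n)
  show ?case using Suc[of "w div 2" "step w s"] code_dist_step_le[of w s] by simp
qed simp

text \<open>At each step some direction preserves the distance, because the distance of two pairs is the
  maximum over the two components.  Together with \<open>code_dist_walk_le\<close>: the distance is the maximum
  over the \<open>2 ^ n\<close> walks of length \<open>n\<close>.\<close>

lemma code_dist_walk_eq: "\<exists>w<2 ^ n. code_dist (walk n w s) = code_dist s"
proof (induction n arbitrary: s)
  case (Suc n)
  obtain b where b: "b < 2" "code_dist (step b s) = code_dist s" using code_dist_step_eq by blast
  obtain w where w: "w < 2 ^ n" "code_dist (walk n w (step b s)) = code_dist (step b s)" using Suc by blast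
  have "step (2 * w + b) s = step b s" using b(1) by (simp add: step_def child_def)
  moreover have "(2 * w + b) div 2 = w" using b(1) by simp
  ultimately have "code_dist (walk (Suc n) (2 * w + b) s) = code_dist s" using b w by simp
  moreover have "2 * w + b < 2 ^ Suc n" using b(1) w(1) by simp
  ultimately show ?case by blast
qed simp

text \<open>Both codes have the form \<open>2 * i + 2\<close>, which stands for the point \<open>\<alpha> i\<close> of \<open>X\<close>.\<close>

definition base_codes :: "nat \<Rightarrow> bool" where
  "base_codes s \<longleftrightarrow> even (left s) \<and> even (right s) \<and> left s \<noteq> 0 \<and> right s \<noteq> 0"

abbreviation base_index :: "nat \<Rightarrow> nat" where
  "base_index n \<equiv> n div 2 - 1"

text \<open>At the end of a long enough walk the distance is given by a formula without recursion.\<close>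

lemma code_dist_leaf:
  assumes "leaf s"
  shows "code_dist s = (if left s = 0 \<and> right s = 0 then 0
    else if base_codes s then min (d (\<alpha> (base_index (left s))) (\<alpha> (base_index (right s)))) 1 else 1)"
  by (cases "left s" rule: code_cases; cases "right s" rule: code_cases)
    (use assms in \<open>simp_all add: code_dist_def base_codes_def leaf_def\<close>)

lemma decidable_base_codes:
  "total_recursive n f \<Longrightarrow> decidable n (\<lambda>xs. base_codes (f xs))"
  unfolding base_codes_def by (intro pairing_intros)

text \<open>A maximum is less than \<open>q\<close> iff all of the finitely many values are, and for each leaf this is
  confirmed at some stage \<open>t\<close>.  Since confirmations persist, one stage serves all leaves, so the
  existential quantifier over stages can be moved in front of the bounded universal one.\<close>

lemma semicomputable_star:
  assumes "semicomputable d \<alpha>"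
  shows "semicomputable ds \<alpha>s"
proof -
  obtain f where f: "total_recursive (Suc 4) f" and
    A: "{[i, j, k, l] | i j k l. d (\<alpha> i) (\<alpha> j) < (real k + 1) / (real l + 1)} =
      {xs. length xs = 4 \<and> (\<exists>t. f (t # xs) = 0)}"
    using assms recursively_enumerable_imp_projection unfolding semicomputable_def by blast
  have d_less: "d (\<alpha> i) (\<alpha> j) < (real k + 1) / (real l + 1) \<longleftrightarrow> (\<exists>t. f [t, i, j, k, l] = 0)"
    for i j k l
  proof -
    have "d (\<alpha> i) (\<alpha> j) < (real k + 1) / (real l + 1) \<longleftrightarrow> [i, j, k, l] \<in>
      {[i, j, k, l] | i j k l. d (\<alpha> i) (\<alpha> j) < (real k + 1) / (real l + 1)}"
      by simp
    then show ?thesis unfolding A by simp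
  qed
  \<comment> \<open>The disjunct \<open>l < k\<close> says that the bound exceeds 1, which bounds all distances.\<close>
  define confirmed where "confirmed t s k l \<longleftrightarrow> l < k \<or> (left s = 0 \<and> right s = 0) \<or>
      base_codes s \<and> (\<exists>t'<Suc t. f [t', base_index (left s), base_index (right s), k, l] = 0)" for t s k l
  have mono: "confirmed t' s k l" if "confirmed t s k l" "t \<le> t'" for t t' s k l
    using that unfolding confirmed_def by (meson less_le_trans Suc_le_mono)
  have code_dist_less: "code_dist s < (real k + 1) / (real l + 1) \<longleftrightarrow> (\<exists>t. confirmed t s k l)"
    if "leaf s" for s k l
  proof -
    let ?q = "(real k + 1) / (real l + 1)"
    have q: "1 < ?q \<longleftrightarrow> l < k" "0 < ?q" by (simp_all add: less_divide_eq)
    consider "left s = 0 \<and> right s = 0" | "base_codes s" "\<not> (left s = 0 \<and> right s = 0)"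
      | "\<not> base_codes s" "\<not> (left s = 0 \<and> right s = 0)" by blast
    then show ?thesis
    proof cases
      case 1
      then show ?thesis using q by (simp add: code_dist_leaf[OF that] confirmed_def)
    next
      case 2
      let ?i = "base_index (left s)" and ?j = "base_index (right s)"
      have "code_dist s < ?q \<longleftrightarrow> l < k \<or> d (\<alpha> ?i) (\<alpha> ?j) < ?q"
        using 2 q by (auto simp: code_dist_leaf[OF that] min_less_iff_disj)
      also have "\<dots> \<longleftrightarrow> l < k \<or> (\<exists>t. f [t, ?i, ?j, k, l] = 0)" by (simp only: d_less)
      also have "\<dots> \<longleftrightarrow> (\<exists>t. confirmed t s k l)" using 2 unfolding confirmed_def by blast
      finally show ?thesis .
    next
      case 3
      then show ?thesis using q by (auto simp: code_dist_leaf[OF that] confirmed_def)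
    qed
  qed
  define confirmed_all where "confirmed_all xs \<longleftrightarrow>
      (\<forall>w<2 ^ (xs ! 1). confirmed (xs ! 0) (walk (xs ! 1) w (J (xs ! 1) (xs ! 2))) (xs ! 3) (xs ! 4))"
    for xs
  have ds_less: "ds (\<alpha>s i) (\<alpha>s j) < (real k + 1) / (real l + 1) \<longleftrightarrow> (\<exists>t. confirmed_all [t, i, j, k, l])"
    for i j k l
  proof -
    define s where "s w = walk i w (J i j)" for w
    have leaf: "leaf (s w)" for w unfolding s_def by (rule leaf_walk) simp
    have "ds (\<alpha>s i) (\<alpha>s j) = code_dist (J i j)" by (simp add: code_dist_def)
    moreover have "code_dist (J i j) < q \<longleftrightarrow> (\<forall>w<2 ^ i. code_dist (s w) < q)" for q
      unfolding s_def using code_dist_walk_le code_dist_walk_eq by (metis le_less_trans)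
    moreover have "(\<forall>w<2 ^ i. \<exists>t. confirmed t (s w) k l) \<longleftrightarrow> (\<exists>t. \<forall>w<2 ^ i. confirmed t (s w) k l)"
    proof
      assume "\<forall>w<2 ^ i. \<exists>t. confirmed t (s w) k l"
      then obtain t where t: "\<And>w. w < 2 ^ i \<Longrightarrow> confirmed (t w) (s w) k l" by metis
      have "confirmed (Max (t ` {..<2 ^ i})) (s w) k l" if "w < 2 ^ i" for w
        by (rule mono[OF t[OF that]]) (use that in simp)
      then show "\<exists>t. \<forall>w<2 ^ i. confirmed t (s w) k l" by blast
    qed blast
    ultimately show ?thesis using code_dist_less[OF leaf] by (simp add: confirmed_all_def s_def)
  qed
  have f': "total_recursive n (\<lambda>xs. f [a xs, b xs, c xs, e xs, h xs])"
    if "total_recursive n a" "total_recursive n b" "total_recursive n c" "total_recursive n e"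
      "total_recursive n h" for n a b c e h
    using total_recursive.subst[of "[a, b, c, e, h]" f n] f that by (simp add: eval_nat_numeral)
  have "decidable (Suc 4) confirmed_all"
    unfolding confirmed_all_def confirmed_def
    by (intro decidable_ball decidable_bex pairing_intros decidable_base_codes total_recursive_walk f') auto
  then have "recursively_enumerable 4 {xs. length xs = 4 \<and> (\<exists>t. (if confirmed_all (t # xs) then 0 else 1) = (0::nat))}"
    unfolding decidable_def by (rule recursively_enumerable_projection)
  moreover have "{xs. length xs = 4 \<and> (\<exists>t. (if confirmed_all (t # xs) then 0 else 1) = (0::nat))} =
      {[i, j, k, l] | i j k l. ds (\<alpha>s i) (\<alpha>s j) < (real k + 1) / (real l + 1)}"
    unfolding ds_less by (auto simp: numeral_eq_Suc length_Suc_conv)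
  ultimately show ?thesis unfolding semicomputable_def by simp
qed

text \<open>At a leaf the approximation \<open>q\<close> is that of \<open>d\<close> truncated at 1, or exact.  Replacing each term
  of a finite maximum by an approximation changes the maximum by no more than the error, so it
  suffices to evaluate \<open>q\<close> at a leaf where it is largest.  Such a leaf is found by minimization,
  values of \<open>q\<close> being compared by cross-multiplication.\<close>

lemma computable_star:
  assumes "computable d \<alpha>"
  shows "computable ds \<alpha>s"
proof -
  obtain a b c where rec: "total_recursive 3 a" "total_recursive 3 b" "total_recursive 3 c"
    and near: "\<bar>(real (a [i, j, k]) - real (b [i, j, k])) / (real (c [i, j, k]) + 1) - d (\<alpha> i) (\<alpha> j)\<bar>
      < 1 / 2 ^ k" for i j k
  proof -
    obtain \<delta> a b c where "total_recursive 3 a" "total_recursive 3 b" "total_recursive 3 c"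
      and \<delta>: "\<And>i j k. \<delta> i j k =
        (of_nat (a [i, j, k]) - of_nat (b [i, j, k])) / (of_nat (c [i, j, k]) + 1)"
      and "\<And>i j k. \<bar>real_of_rat (\<delta> i j k) - d (\<alpha> i) (\<alpha> j)\<bar> < 1 / 2 ^ k"
      using assms unfolding computable_def computable_rat_fun3_def by metis
    then show thesis
      using that[of a b c] by (simp add: \<delta> of_rat_divide of_rat_diff of_rat_add)
  qed
  have comp3: "total_recursive n (\<lambda>xs. f [u xs, v xs, w xs])"
    if "total_recursive 3 f" "total_recursive n u" "total_recursive n v" "total_recursive n w"
    for n f u v w
    using total_recursive.subst[of "[u, v, w]" f n] that by (simp add: eval_nat_numeral)
  let ?i = "\<lambda>s. base_index (left s)" and ?j = "\<lambda>s. base_index (right s)"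
  \<comment> \<open>The rational \<open>(a - b) / (c + 1)\<close> is less than 1, so that truncation leaves it unchanged.\<close>
  define small where "small s k \<longleftrightarrow> base_codes s \<and> a [?i s, ?j s, k] < b [?i s, ?j s, k] + Suc (c [?i s, ?j s, k])"
    for s k
  define A where "A s k = (if small s k then a [?i s, ?j s, k] else if left s = 0 \<and> right s = 0 then 0 else 1)"
    for s k
  define B where "B s k = (if small s k then b [?i s, ?j s, k] else 0)" for s k
  define C where "C s k = (if small s k then c [?i s, ?j s, k] else 0)" for s k
  define q where "q s k = (real (A s k) - real (B s k)) / (real (C s k) + 1)" for s k
  have recABC: "total_recursive n (\<lambda>xs. A (f xs) (g xs))" "total_recursive n (\<lambda>xs. B (f xs) (g xs))"
    "total_recursive n (\<lambda>xs. C (f xs) (g xs))"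
    if "total_recursive n f" "total_recursive n g" for n f g
    unfolding A_def B_def C_def small_def
    by (intro pairing_intros decidable_base_codes comp3[OF rec(1)] comp3[OF rec(2)] comp3[OF rec(3)] that)+
  have q_near: "\<bar>q s k - code_dist s\<bar> < 1 / 2 ^ k" if "leaf s" for s k
  proof (cases "base_codes s")
    case True
    then have dist: "code_dist s = min (d (\<alpha> (?i s)) (\<alpha> (?j s))) 1"
      using code_dist_leaf[OF that] by (simp add: base_codes_def)
    let ?r = "(real (a [?i s, ?j s, k]) - real (b [?i s, ?j s, k])) / (real (c [?i s, ?j s, k]) + 1)"
    have "small s k \<longleftrightarrow> ?r < 1" using True by (auto simp: small_def divide_less_eq)
    then have "q s k = min ?r 1"
      using True by (auto simp: q_def A_def B_def C_def base_codes_def)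
    then show ?thesis using near[of "?i s" "?j s" k] dist by linarith
  next
    case False
    then have "q s k = code_dist s" using code_dist_leaf[OF that] by (auto simp: q_def A_def B_def C_def small_def)
    then show ?thesis by simp
  qed
  have q_le: "q s k \<le> q s' k \<longleftrightarrow> A s k * Suc (C s' k) + B s' k * Suc (C s k) \<le>
      A s' k * Suc (C s k) + B s k * Suc (C s' k)" for s s' k
  proof -
    have "q s k \<le> q s' k \<longleftrightarrow> (real (A s k) - real (B s k)) * real (Suc (C s' k)) \<le>
        (real (A s' k) - real (B s' k)) * real (Suc (C s k))"
      unfolding q_def by (simp add: frac_le_eq field_simps)
    also have "\<dots> \<longleftrightarrow> real (A s k * Suc (C s' k) + B s' k * Suc (C s k)) \<le>
        real (A s' k * Suc (C s k) + B s k * Suc (C s' k))"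
      by (simp add: algebra_simps)
    finally show ?thesis by (simp only: of_nat_le_iff)
  qed
  define good where "good w i j k \<longleftrightarrow> w < 2 ^ i \<and>
      (\<forall>v<2 ^ i. q (walk i v (J i j)) k \<le> q (walk i w (J i j)) k)" for w i j k
  define best where "best i j k = (LEAST w. good w i j k)" for i j k
  have ex_good: "\<exists>w. good w i j k" for i j k
  proof -
    let ?Q = "\<lambda>w. q (walk i w (J i j)) k"
    have fin: "finite (?Q ` {..<2 ^ i})" "?Q ` {..<2 ^ i} \<noteq> {}"
      by (auto simp: lessThan_empty_iff)
    obtain w where "w < 2 ^ i" "?Q w = Max (?Q ` {..<2 ^ i})" using Max_in[OF fin] by auto
    then show ?thesis unfolding good_def using Max_ge[OF fin(1)] by (metis imageI lessThan_iff)
  qed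
  then have good: "good (best i j k) i j k" for i j k unfolding best_def by (rule LeastI_ex)
  have "decidable (Suc 3) (\<lambda>ys. good (ys ! 0) (tl ys ! 0) (tl ys ! 1) (tl ys ! 2))"
    unfolding good_def q_le
    by (intro decidable_ball pairing_intros recABC total_recursive_walk) auto
  then have "total_recursive 3 (\<lambda>xs. best (xs ! 0) (xs ! 1) (xs ! 2))"
    unfolding best_def by (rule total_recursive_Least) (rule ex_good)
  then have rec_leaf: "total_recursive 3 (\<lambda>xs. walk (xs ! 0) (best (xs ! 0) (xs ! 1) (xs ! 2)) (J (xs ! 0) (xs ! 1)))"
    by (intro total_recursive_walk total_recursive_J total_recursive.proj) auto
  define s where "s i j k = walk i (best i j k) (J i j)" for i j k
  define \<delta> :: "nat \<Rightarrow> nat \<Rightarrow> nat \<Rightarrow> rat" where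
    "\<delta> i j k = (of_nat (A (s i j k) k) - of_nat (B (s i j k) k)) / (of_nat (C (s i j k) k) + 1)" for i j k
  have "total_recursive 3 (\<lambda>xs. A (s (xs ! 0) (xs ! 1) (xs ! 2)) (xs ! 2))"
    "total_recursive 3 (\<lambda>xs. B (s (xs ! 0) (xs ! 1) (xs ! 2)) (xs ! 2))"
    "total_recursive 3 (\<lambda>xs. C (s (xs ! 0) (xs ! 1) (xs ! 2)) (xs ! 2))"
    unfolding s_def by (intro recABC rec_leaf total_recursive.proj; simp)+
  then have "computable_rat_fun3 \<delta>"
    unfolding computable_rat_fun3_def
    by (intro exI conjI) (assumption+, simp add: \<delta>_def)
  moreover have "\<bar>real_of_rat (\<delta> i j k) - ds (\<alpha>s i) (\<alpha>s j)\<bar> < 1 / 2 ^ k" for i j k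
  proof -
    have leaf: "leaf (walk i w (J i j))" for w by (rule leaf_walk) simp
    obtain w where w: "w < 2 ^ i" "code_dist (walk i w (J i j)) = code_dist (J i j)" using code_dist_walk_eq by blast
    have "real_of_rat (\<delta> i j k) = q (s i j k) k"
      by (simp add: \<delta>_def q_def of_rat_divide of_rat_diff of_rat_add)
    moreover have "ds (\<alpha>s i) (\<alpha>s j) = code_dist (J i j)" by (simp add: code_dist_def)
    moreover have "q (walk i w (J i j)) k \<le> q (s i j k) k"
      using good[of i j k] w(1) by (simp add: good_def s_def)
    moreover have "code_dist (s i j k) \<le> code_dist (J i j)" unfolding s_def by (rule code_dist_walk_le)
    moreover have "\<bar>q (s i j k) k - code_dist (s i j k)\<bar> < 1 / 2 ^ k"
      unfolding s_def by (rule q_near[OF leaf])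
    ultimately show ?thesis using q_near[OF leaf[of w], of k] w(2) by linarith
  qed
  ultimately show ?thesis unfolding computable_def by blast
qed

end

theorem proposition2p2:
  fixes X :: "'a set" and d :: "'a \<Rightarrow> 'a \<Rightarrow> real" and \<alpha> :: "nat \<Rightarrow> 'a"
    and \<rho> :: "(nat \<Rightarrow> nat) \<rightharpoonup> 'a"
    and \<oo> :: 'a and pr :: "'a \<Rightarrow> 'a \<Rightarrow> 'a" and J :: "nat \<Rightarrow> nat \<Rightarrow> nat"
  assumes "effective_metric_space X d \<alpha>"
    and "generates X d \<alpha> \<rho>"
    and "moschovakis_base X \<oo> pr"
    and "admissible_pairing J"
  shows "effective_metric_space (star X \<oo> pr) (d_star X \<oo> pr d) (alpha_star J \<oo> pr \<alpha>)
    \<and> generates (star X \<oo> pr) (d_star X \<oo> pr d) (alpha_star J \<oo> pr \<alpha>) (rho_star J \<oo> pr \<rho>)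
    \<and> (semicomputable d \<alpha> \<longrightarrow> semicomputable (d_star X \<oo> pr d) (alpha_star J \<oo> pr \<alpha>))
    \<and> (computable d \<alpha> \<longrightarrow> computable (d_star X \<oo> pr d) (alpha_star J \<oo> pr \<alpha>))"
proof -
  interpret moschovakis_extension X d \<alpha> J \<oo> pr
    using assms
    by (intro moschovakis_extension.intro pairing.intro moschovakis_extension_axioms.intro)
  show ?thesis
    using effective_metric_space_star generates_star[OF assms(2)] semicomputable_star computable_star
    by blast
qed

end
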